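(* Let $t=q^{-1}+\sum_{m\ge1}H_mq^m$ be a normalized $q$-series, let $t_0=q^{-1}+\sum_{m\ge1}h_mq^m$ be a replicable normalized $q$-series with replicates $t_0^{(s)}=q^{-1}+\sum_{m\ge1}h^{(s)}_mq^m$ ($s\ge1$), and let $\psi$ be a $\{\pm1\}$-valued function on pairs $(m,n)$ as described in the context. The following are equivalent: (a) $t$ is super-replicable with respect to $t_0$ and $\psi$, i.e. $\psi(a,b)(2H_{a,b}-h_{a,b})=\psi(c,d)(2H_{c,d}-h_{c,d})$ whenever $a,b,c,d$ are positive integers with $ab=cd$ and $\gcd(a,b)=\gcd(c,d)$. (b) For every $s\ge1$ there is a normalized $q$-series $F^{(s)}=q^{-1}+\sum_{m\ge1}F^{(s)}_mq^m$ such that $F^{(1)}=2t-t_0$ and, for every $n\ge1$, $$\sum_{m\in\mathbb Z}\psi(m,n)(2H_{m,n}-h_{m,n})\,q^m=\frac1n\sum_{\substack{ad=n\\ 0\le b<d}}F^{(a)}\!\left(\frac{az+b}{d}\right).$$ (c) For every $s\ge1$ there is a normalized $q$-series $F^{(s)}=q^{-1}+\sum_{m\ge1}F^{(s)}_mq^m$ such that $$p^{-1}\prod_{\substack{n>0\\ m\in\mathbb Z}}\exp\!\left(-\sum_{s\ge1}\frac{\psi(sm,sn)F^{(s)}_{mn}+h^{(s)}_{mn}}{2s}\,q^{sm}p^{sn}\right)=t(p)-t(q),$$ where $p=e^{2\pi iy}$, $q=e^{2\pi iz}$ ($y,z$ in the upper half plane).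
   Context: A normalized $q$-series is a formal series $q^{-1}+\sum_{m\ge1}c_mq^m$ with complex coefficients, where $q=e^{2\pi iz}$. For such $u$ and $n\ge1$, the Faber polynomial $X_n(u)$ is the unique polynomial in $u$ with $X_n(u)-\frac1nq^{-n}\in q\mathbb C[[q]]$. Write $X_n(t)=\sum_{m\in\mathbb Z}H_{m,n}q^m$ and $X_n(t_0)=\sum_{m\in\mathbb Z}h_{m,n}q^m$ (so $H_{-n,n}=h_{-n,n}=1/n$, $H_{m,n}=h_{m,n}=0$ for $m\le 0$, $m\ne-n$, and $H_{m,1}=H_m$, $h_{m,1}=h_m$). $t_0$ is replicable with replicates $t_0^{(s)}$ means: $t_0^{(1)}=t_0$ and $h_{m,n}=\sum_{s\mid\gcd(m,n)}\frac1s h^{(s)}_{mn/s^2}$ for all positive integers $m,n$ (equivalently $X_n(t_0)=n^{-1}\sum_{ad=n,0\le b<d}t_0^{(a)}((az+b)/d)$). The function $\psi$ takes values $\pm1$ on pairs of positive integers and satisfies $\psi(m,1)=1$ for all $m\ge1$; it is extended by $\psi(-n,n)=1$ for $n\ge1$ (other pairs with $m\le0$ carry zero coefficients and their $\psi$-values are irrelevant). For normalized series $F^{(s)}$ and $t_0^{(s)}$ one sets $F^{(s)}_{-1}=h^{(s)}_{-1}=1$ and $F^{(s)}_m=h^{(s)}_m=0$ for $m=0$ and $m\le-2$. Both sides of the identity in (c) are regarded as expansions in powers of $p$ with coefficients Laurent series in $q$. *)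

theory Defs
  imports Complex_Main "HOL-Computational_Algebra.Computational_Algebra"
begin

unbundle fps_syntax

text \<open>
  A \<open>q\<close>-series with at most a pole at infinity is a formal Laurent series over \<open>\<complex>\<close> in the variable \<open>q\<close>.
\<close>

definition normalized_qseries :: "complex fls \<Rightarrow> bool" where
  "normalized_qseries u \<longleftrightarrow> u $$ (-1) = 1 \<and> u $$ 0 = 0 \<and> (\<forall>m < -1. u $$ m = 0)"

definition eval_at_series :: "complex poly \<Rightarrow> complex fls \<Rightarrow> complex fls" where
  "eval_at_series P u = poly (map_poly fls_const P) u"

definition is_faber_poly :: "complex fls \<Rightarrow> nat \<Rightarrow> complex poly \<Rightarrow> bool" where
  "is_faber_poly u n P \<longleftrightarrow>
     (\<forall>k \<le> 0. (eval_at_series P u - fls_const (1 / of_nat n) * fls_X_intpow (- int n)) $$ k = 0)"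

definition faber_poly :: "complex fls \<Rightarrow> nat \<Rightarrow> complex poly" where
  "faber_poly u n = (THE P. is_faber_poly u n P)"

text \<open>
  \<open>faber_coeff u m n\<close> is the coefficient of \<open>q\<^sup>m\<close> in \<open>X\<^sub>n(u)\<close>: it is written \<open>H\<^sub>m\<^sub>,\<^sub>n\<close> for \<open>u = t\<close>
  and \<open>h\<^sub>m\<^sub>,\<^sub>n\<close> for \<open>u = t\<^sub>0\<close>.
\<close>

definition faber_coeff :: "complex fls \<Rightarrow> int \<Rightarrow> nat \<Rightarrow> complex" where
  "faber_coeff u m n = eval_at_series (faber_poly u n) u $$ m"

definition replicable_with :: "complex fls \<Rightarrow> (nat \<Rightarrow> complex fls) \<Rightarrow> bool" where
  "replicable_with t\<^sub>0 r \<longleftrightarrow>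
     normalized_qseries t\<^sub>0 \<and> (\<forall>s \<ge> 1. normalized_qseries (r s)) \<and> r 1 = t\<^sub>0 \<and>
     (\<forall>m n :: nat. m > 0 \<longrightarrow> n > 0 \<longrightarrow>
        faber_coeff t\<^sub>0 (int m) n =
          (\<Sum>s | s dvd gcd m n. 1 / of_nat s * r s $$ int (m * n div s\<^sup>2)))"

text \<open>
  Only the values of \<open>\<psi>\<close> on pairs of positive integers and on the pairs \<open>(-n, n)\<close> are constrained;
  all other values are multiplied by zero coefficients wherever they occur below.
\<close>

definition admissible_sign :: "(int \<Rightarrow> nat \<Rightarrow> int) \<Rightarrow> bool" where
  "admissible_sign \<psi> \<longleftrightarrow>
     (\<forall>m > 0. \<forall>n > 0. \<psi> m n \<in> {1, -1}) \<and>
     (\<forall>m > 0. \<psi> m 1 = 1) \<and>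
     (\<forall>n > 0. \<psi> (- int n) n = 1)"

definition twisted_coeff ::
    "complex fls \<Rightarrow> complex fls \<Rightarrow> (int \<Rightarrow> nat \<Rightarrow> int) \<Rightarrow> int \<Rightarrow> nat \<Rightarrow> complex" where
  "twisted_coeff t t\<^sub>0 \<psi> m n = of_int (\<psi> m n) * (2 * faber_coeff t m n - faber_coeff t\<^sub>0 m n)"

definition super_replicable :: "complex fls \<Rightarrow> complex fls \<Rightarrow> (int \<Rightarrow> nat \<Rightarrow> int) \<Rightarrow> bool" where
  "super_replicable t t\<^sub>0 \<psi> \<longleftrightarrow>
     (\<forall>a b c d :: nat. a > 0 \<longrightarrow> b > 0 \<longrightarrow> c > 0 \<longrightarrow> d > 0 \<longrightarrow>
        a * b = c * d \<longrightarrow> gcd a b = gcd c d \<longrightarrow>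
        twisted_coeff t t\<^sub>0 \<psi> (int a) b = twisted_coeff t t\<^sub>0 \<psi> (int c) d)"

text \<open>
  The series \<open>\<Sum>\<^sub>m \<psi>(m,n) (2H\<^sub>m\<^sub>,\<^sub>n - h\<^sub>m\<^sub>,\<^sub>n) q\<^sup>m\<close>. The coefficient function vanishes below \<open>-n\<close> for
  normalized \<open>t\<close>, \<open>t\<^sub>0\<close> and \<open>n \<ge> 1\<close>, so \<open>Abs_fls\<close> is harmless (see \<open>twisted_series_nth\<close> below).
\<close>

definition twisted_series ::
    "complex fls \<Rightarrow> complex fls \<Rightarrow> (int \<Rightarrow> nat \<Rightarrow> int) \<Rightarrow> nat \<Rightarrow> complex fls" where
  "twisted_series t t\<^sub>0 \<psi> n = Abs_fls (\<lambda>m. twisted_coeff t t\<^sub>0 \<psi> m n)"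

text \<open>
  The series \<open>F((az+b)/d)\<close> lives in fractional powers of \<open>q\<close>. Put \<open>n = ad\<close> and \<open>w = exp(2\<pi>iz/n)\<close>, so
  that \<open>q = w\<^sup>n\<close>. The substitution \<open>z \<mapsto> (az+b)/d\<close> sends \<open>q\<close> to
  \<open>exp(2\<pi>ib/d) q\<^bsup>a/d\<^esup> = exp(2\<pi>ib/d) w\<^bsup>a\<^sup>2\<^esup>\<close>; \<open>hecke_subst F a b d\<close> is the result as a Laurent series
  in \<open>w\<close>. A series in \<open>q\<close> becomes a series in \<open>w\<close> by \<open>\<lambda>f. fls_compose_power f n\<close>.
\<close>

definition hecke_subst :: "complex fls \<Rightarrow> nat \<Rightarrow> nat \<Rightarrow> nat \<Rightarrow> complex fls" where
  "hecke_subst F a b d =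
     fls_compose_fps F (fps_const (exp (2 * of_real pi * \<i> * of_nat b / of_nat d)) * fps_X ^ (a\<^sup>2))"

text \<open>
  Expansions in powers of \<open>p\<close> with coefficients Laurent series in \<open>q\<close>: the ring \<open>\<complex>((q))((p))\<close> is
  \<open>complex fls fls\<close>, and \<open>\<complex>((q))[[p]]\<close> is \<open>complex fls fps\<close>; in both, the outer variable is \<open>p\<close>.
  An infinite product of elements of \<open>\<complex>((q))[[p]]\<close> has the value \<open>P\<close> if every coefficient of
  \<open>p\<^sup>i q\<^sup>j\<close> in the finite subproducts is eventually constant, equal to that of \<open>P\<close>.
\<close>

definition has_formal_prod ::
    "('i \<Rightarrow> complex fls fps) \<Rightarrow> 'i set \<Rightarrow> complex fls fps \<Rightarrow> bool" where
  "has_formal_prod f I P \<longleftrightarrow>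
     (\<forall>i j. \<forall>\<^sub>F A in finite_subsets_at_top I. ((\<Prod>x\<in>A. f x) $ i) $$ j = (P $ i) $$ j)"

definition series_in_p :: "complex fls \<Rightarrow> complex fls fls" where
  "series_in_p u = Abs_fls (\<lambda>m. fls_const (u $$ m))"

definition series_in_q :: "complex fls \<Rightarrow> complex fls fls" where
  "series_in_q u = fls_const u"

text \<open>
  The exponent \<open>\<Sum>\<^sub>s (\<psi>(sm,sn) F\<^sup>(\<^sup>s\<^sup>)\<^sub>m\<^sub>n + r\<^sup>(\<^sup>s\<^sup>)\<^sub>m\<^sub>n)/(2s) q\<^sup>s\<^sup>m p\<^sup>s\<^sup>n\<close>, sorted by powers of \<open>p\<close>.
  For normalized series, \<open>$$ (m * int n)\<close> already yields the conventional values (\<open>1\<close> or \<open>0\<close>) at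
  indices \<open>mn \<le> 0\<close>.
\<close>

definition factor_exponent ::
    "(int \<Rightarrow> nat \<Rightarrow> int) \<Rightarrow> (nat \<Rightarrow> complex fls) \<Rightarrow> (nat \<Rightarrow> complex fls) \<Rightarrow> int \<Rightarrow> nat \<Rightarrow>
     complex fls fps" where
  "factor_exponent \<psi> F r m n =
     Abs_fps (\<lambda>N. \<Sum>s | s \<ge> 1 \<and> s * n = N.
       fls_const ((of_int (\<psi> (int s * m) (s * n)) * F s $$ (m * int n) + r s $$ (m * int n))
                   / (2 * of_nat s)) * fls_X_intpow (int s * m))"

text \<open>The exponential of a series in \<open>p \<complex>((q))[[p]]\<close>.\<close>

definition formal_exp :: "complex fls fps \<Rightarrow> complex fls fps" where
  "formal_exp g = fps_compose (fps_exp 1) g"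

subsection \<open>Well-definedness\<close>

lemma eval_at_series_simps:
  "eval_at_series 0 u = 0"
  "eval_at_series (P + Q) u = eval_at_series P u + eval_at_series Q u"
  "eval_at_series (P - Q) u = eval_at_series P u - eval_at_series Q u"
  "eval_at_series (monom c n) u = fls_const c * u ^ n"
proof -
  have hom: "map_poly fls_const (P + Q) = map_poly fls_const P + map_poly fls_const Q"
    "map_poly fls_const (P - Q) = map_poly fls_const P - map_poly fls_const Q" for P Q :: "complex poly"
    by (intro poly_eqI; simp add: coeff_map_poly fls_plus_const fls_minus_const)+
  show "eval_at_series 0 u = 0"
    "eval_at_series (P + Q) u = eval_at_series P u + eval_at_series Q u"
    "eval_at_series (P - Q) u = eval_at_series P u - eval_at_series Q u"
    "eval_at_series (monom c n) u = fls_const c * u ^ n"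
    by (simp_all add: eval_at_series_def hom map_poly_monom poly_monom)
qed

lemma normalized_subdegree:
  assumes "normalized_qseries u"
  shows "fls_subdegree u = -1"
  using assms unfolding normalized_qseries_def by (intro fls_subdegree_eqI) auto

lemma normalized_power:
  assumes "normalized_qseries u"
  shows "fls_subdegree (u ^ n) = - int n" "(u ^ n) $$ (- int n) = 1"
proof -
  show sd: "fls_subdegree (u ^ n) = - int n" for n
    using normalized_subdegree[OF assms] by (simp add: fls_subdegree_pow)
  show "(u ^ n) $$ (- int n) = 1"
  proof (induction n)
    case (Suc n)
    have "(u * u ^ n) $$ (fls_subdegree u + fls_subdegree (u ^ n)) = u $$ (-1) * (u ^ n) $$ (- int n)"
      using sd[of n] normalized_subdegree[OF assms] by (subst fls_times_base) simp
    moreover have "u $$ (-1) = 1"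
      using assms by (simp add: normalized_qseries_def)
    moreover have "fls_subdegree u + fls_subdegree (u ^ n) = - int (Suc n)"
      using sd[of n] normalized_subdegree[OF assms] by simp
    ultimately show ?case using Suc.IH by simp
  qed simp
qed

lemma polynomial_part_exists:
  assumes "normalized_qseries u" "\<forall>k < - int n. g $$ k = 0"
  shows "\<exists>P. \<forall>k \<le> 0. (eval_at_series P u - g) $$ k = 0"
  using assms(2)
proof (induction n arbitrary: g)
  case 0
  then show ?case
    by (intro exI[of _ "monom (g $$ 0) 0"]) (auto simp: eval_at_series_simps)
next
  case (Suc n)
  define c where "c = g $$ (- int (Suc n))"
  have "(g - fls_const c * u ^ Suc n) $$ k = 0" if "k < - int n" for k
  proof (cases "k = - int (Suc n)")
    case True
    then show ?thesis
      using normalized_power(2)[OF assms(1), of "Suc n"] by (simp add: c_def del: power_Suc)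
  next
    case False
    with that have "k < - int (Suc n)" by simp
    then show ?thesis
      using Suc.prems normalized_power(1)[OF assms(1), of "Suc n"]
      by (simp del: power_Suc)
  qed
  from Suc.IH[of "g - fls_const c * u ^ Suc n"] this obtain P where
    "\<forall>k \<le> 0. (eval_at_series P u - (g - fls_const c * u ^ Suc n)) $$ k = 0" by blast
  then show ?case
    by (intro exI[of _ "P + monom c (Suc n)"])
       (auto simp: eval_at_series_simps algebra_simps simp del: power_Suc)
qed

lemma eval_at_series_lead:
  assumes "normalized_qseries u"
  shows "eval_at_series P u $$ (- int (degree P)) = lead_coeff P"
proof -
  have "eval_at_series P u = (\<Sum>i\<le>degree P. fls_const (coeff P i) * u ^ i)"
    by (simp add: eval_at_series_def poly_altdef coeff_map_poly degree_map_poly)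
  then have "eval_at_series P u $$ (- int (degree P)) =
      (\<Sum>i\<le>degree P. coeff P i * (u ^ i) $$ (- int (degree P)))"
    by (simp add: fls_nth_sum)
  also have "\<dots> = (\<Sum>i\<le>degree P. if i = degree P then coeff P i else 0)"
    using normalized_power[OF assms] by (intro sum.cong) auto
  finally show ?thesis by simp
qed

lemma faber_poly_ex1:
  assumes "normalized_qseries u"
  shows "\<exists>!P. is_faber_poly u n P"
proof (rule ex_ex1I)
  show "\<exists>P. is_faber_poly u n P"
    unfolding is_faber_poly_def
    by (rule polynomial_part_exists[OF assms, of n]) auto
next
  fix P Q assume "is_faber_poly u n P" "is_faber_poly u n Q"
  then have "eval_at_series (P - Q) u $$ k = 0" if "k \<le> 0" for k
    using that by (simp add: is_faber_poly_def eval_at_series_simps)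
  then have "lead_coeff (P - Q) = 0"
    using eval_at_series_lead[OF assms, of "P - Q"] by simp
  then have "P - Q = 0" by (simp only: leading_coeff_0_iff)
  then show "P = Q" by simp
qed

lemma faber_poly_correct:
  assumes "normalized_qseries u"
  shows "is_faber_poly u n (faber_poly u n)"
  unfolding faber_poly_def by (rule theI'[OF faber_poly_ex1[OF assms]])

lemma faber_coeff_nonpos:
  assumes "normalized_qseries u" "m \<le> 0"
  shows "faber_coeff u m n = (if m = - int n then 1 / of_nat n else 0)"
  using faber_poly_correct[OF assms(1), of n] assms(2)
  by (auto simp: is_faber_poly_def faber_coeff_def)

lemma twisted_series_nth:
  assumes "normalized_qseries t" "normalized_qseries t\<^sub>0"
  shows "twisted_series t t\<^sub>0 \<psi> n $$ m = twisted_coeff t t\<^sub>0 \<psi> m n"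
  unfolding twisted_series_def
  by (rule nth_Abs_fls_lower_bound[where N = "- int n"])
     (auto simp: twisted_coeff_def faber_coeff_nonpos[OF assms(1)] faber_coeff_nonpos[OF assms(2)])

lemma series_in_p_nth: "series_in_p u $$ m = fls_const (u $$ m)"
  unfolding series_in_p_def
  by (rule nth_Abs_fls_lower_bound[where N = "fls_subdegree u"]) auto

end

theory Submission
  imports Defs
begin

text \<open>
  All three conditions say that the twisted coefficients \<open>c(m,n) = \<psi>(m,n) (2H\<^sub>m\<^sub>,\<^sub>n - h\<^sub>m\<^sub>,\<^sub>n)\<close> satisfy
  \<open>c(m,n) = \<Sum>\<^bsub>s | gcd(m,n)\<^esub> F\<^sup>(\<^sup>s\<^sup>)\<^bsub>mn/s^2\<^esub> / s\<close>. The right-hand side depends only on \<open>mn\<close> and \<open>gcd(m,n)\<close>;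
  conversely, for fixed \<open>mn\<close>, inverting over the divisors of the gcd recovers the \<open>F\<^sup>(\<^sup>s\<^sup>)\<close>. This is
  (a). Summing over \<open>b\<close> in (b) annihilates the exponents not divisible by \<open>d\<close> and leaves exactly these
  divisor sums. For (c), the Faber polynomials have the generating function
  \<open>p (t(p) - t(q)) = exp(-\<Sum>\<^sub>n X\<^sub>n(t) p\<^sup>n)\<close>, so comparing logarithms and collecting \<open>q\<^sup>m p\<^sup>n\<close> gives
  \<open>2H\<^sub>m\<^sub>,\<^sub>n = \<psi>(m,n) \<Sum>\<^sub>s F\<^sup>(\<^sup>s\<^sup>)\<^bsub>mn/s^2\<^esub> / s + h\<^sub>m\<^sub>,\<^sub>n\<close>, and \<open>\<psi> = \<plusminus>1\<close>.
\<close>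

subsection \<open>Divisor sums and Hecke operators\<close>

text \<open>Moebius inversion by well-founded recursion along proper divisors: \<open>f n\<close> is
  what \<open>G n\<close> leaves after the values already chosen.\<close>

lemma dirichlet_inversion_exists:
  fixes G :: "nat \<Rightarrow> 'a :: ab_group_add"
  shows "\<exists>f. \<forall>n>0. G n = (\<Sum>s | s dvd n. f s)"
proof -
  define R where "R = {(s, n :: nat). s dvd n \<and> s < n}"
  define step where "step = (\<lambda>f n. G n - (\<Sum>s | s dvd n \<and> s < n. f s))"
  define f where "f = wfrec R step"
  have "wf R"
    by (rule wf_subset[OF wf_less]) (auto simp: R_def)
  then have f_eq: "f n = step (cut f R n) n" for n
    unfolding f_def by (rule wfrec)
  have step_cut: "step (cut f R n) n = step f n" for n
    unfolding step_def by (intro arg_cong2[of _ _ _ _ minus] sum.cong) (auto simp: cut_def R_def)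
  have f_rec: "f n = G n - (\<Sum>s | s dvd n \<and> s < n. f s)" for n
    using trans[OF f_eq step_cut, of n] unfolding step_def .
  have "G n = (\<Sum>s | s dvd n. f s)" if "n > 0" for n
  proof -
    have "{s. s dvd n} = insert n {s. s dvd n \<and> s < n}"
      using that by (auto dest: dvd_imp_le)
    then show ?thesis
      using f_rec[of n] by simp
  qed
  then show ?thesis by blast
qed

text \<open>The \<open>q^m\<close> coefficient of the n-th Hecke operator on the family
  \<open>F\<close>, as \<open>hecke_sum_nth\<close> confirms. Integer \<open>m\<close> covers the
  polar term; for \<open>n\<close> > 0 the sum is finite.\<close>

definition hecke_coeff :: "(nat \<Rightarrow> complex fls) \<Rightarrow> int \<Rightarrow> nat \<Rightarrow> complex" where
  "hecke_coeff F m n =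
     (\<Sum>s | s dvd n \<and> int s dvd m. 1 / of_nat s * F s $$ (m * int n div (int s)\<^sup>2))"

lemma hecke_coeff_nat:
  "hecke_coeff F (int m) n = (\<Sum>s | s dvd gcd m n. 1 / of_nat s * F s $$ int (m * n div s\<^sup>2))"
  unfolding hecke_coeff_def
  by (intro sum.cong) (auto simp: zdiv_int)

lemma hecke_coeff_gcd_mult_cong:
  assumes "a * b = c * d" "gcd a b = gcd c d"
  shows "hecke_coeff F (int a) b = hecke_coeff F (int c) d"
  by (simp add: hecke_coeff_nat assms)

lemma normalized_nth_nonpos:
  assumes "normalized_qseries u" "k \<le> 0"
  shows "u $$ k = (if k = -1 then 1 else 0)"
proof (cases "k < -1")
  case False
  with assms(2) have "k = -1 \<or> k = 0" by auto
  with assms(1) show ?thesis by (auto simp: normalized_qseries_def)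
qed (use assms in \<open>auto simp: normalized_qseries_def\<close>)

text \<open>With n = s x and m = s y the index is x y <= 0, which equals -1 only for x = 1, y = -1.
  The only polar term is thus q^(-n)/n, as for a Faber polynomial.\<close>

lemma hecke_coeff_nonpos:
  assumes "\<forall>s\<ge>1. normalized_qseries (F s)" "n > 0" "m \<le> 0"
  shows "hecke_coeff F m n = (if m = - int n then 1 / of_nat n else 0)"
proof -
  have term_eq: "1 / of_nat s * F s $$ (m * int n div (int s)\<^sup>2) =
      (if s = n then (if m = - int n then 1 / of_nat n else 0) else 0)"
    if s: "s dvd n" "int s dvd m" for s
  proof -
    obtain x where n: "n = s * x" using s(1) by (rule dvdE)
    obtain y where m: "m = int s * y" using s(2) by (rule dvdE)
    have pos: "s > 0" "x > 0" using n assms(2) by auto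
    have y: "y \<le> 0" using m assms(3) pos by (auto simp: mult_le_0_iff)
    have "m * int n div (int s)\<^sup>2 = y * int x"
      using pos by (simp add: n m power2_eq_square)
    moreover have "y * int x \<le> 0"
      using y by (simp add: mult_nonpos_nonneg)
    moreover have "y * int x = -1 \<longleftrightarrow> y = -1 \<and> x = 1"
    proof
      assume "y * int x = -1"
      then have "int x dvd 1" by (metis dvd_minus_iff dvd_triv_right)
      then have "x = 1" by simp
      with \<open>y * int x = -1\<close> show "y = -1 \<and> x = 1" by simp
    qed simp
    ultimately have val: "F s $$ (m * int n div (int s)\<^sup>2) = (if y = -1 \<and> x = 1 then 1 else 0)"
      using normalized_nth_nonpos[of "F s" "y * int x"] assms(1) pos by simp
    have "s = n \<longleftrightarrow> x = 1" "x = 1 \<Longrightarrow> m = - int n \<longleftrightarrow> y = -1"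
      using pos mult_cancel_left[of "int s" y "-1"] by (auto simp: n m)
    then show ?thesis
      unfolding val by (auto simp: n)
  qed
  have "hecke_coeff F m n = (\<Sum>s | s dvd n \<and> int s dvd m.
      if s = n then (if m = - int n then 1 / of_nat n else 0) else 0)"
    unfolding hecke_coeff_def by (rule sum.cong) (use term_eq in auto)
  also have "\<dots> = (if m = - int n then 1 / of_nat n else 0)"
    using assms(2) by (subst sum.delta) auto
  finally show ?thesis .
qed

text \<open>For a fixed product k = mn, \<open>c\<close> depends only on g = gcd(m,n), and inversion
  over divisors gives numbers \<open>f k s\<close>. Since s and k/s^2 determine k, each has its own
  place in \<open>F s\<close>.\<close>

lemma hecke_coeff_exists:
  fixes c :: "nat \<Rightarrow> nat \<Rightarrow> complex"
  assumes c: "\<And>a b x y. \<lbrakk>a > 0; b > 0; x > 0; y > 0; a * b = x * y; gcd a b = gcd x y\<rbrakk>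
      \<Longrightarrow> c a b = c x y"
  shows "\<exists>F. (\<forall>s\<ge>1. normalized_qseries (F s)) \<and> (\<forall>m>0. \<forall>n>0. c m n = hecke_coeff F (int m) n)"
proof -
  \<comment> \<open>Where g^2 does not divide k this inverts arbitrary values; below, only divisors
    s of an actual gcd are read, and for these s^2 divides k.\<close>
  have "\<forall>k. \<exists>f. \<forall>g>0. c g (k div g) = (\<Sum>s | s dvd g. f s)"
    by (intro allI dirichlet_inversion_exists)
  from choice[OF this]
  obtain f where f: "\<And>k g. g > 0 \<Longrightarrow> c g (k div g) = (\<Sum>s | s dvd g. f k s)"
    by blast
  \<comment> \<open>The factor s cancels the weight 1/s, and an index k stands for the product k
    s^2.\<close>
  define F where "F s = Abs_fls (\<lambda>k. if k = -1 then 1 else if k > 0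
      then of_nat s * f (nat k * s\<^sup>2) s else 0)" for s
  have F_nth: "F s $$ k = (if k = -1 then 1 else if k > 0 then of_nat s * f (nat k * s\<^sup>2) s else 0)"
    for s k
    unfolding F_def by (rule nth_Abs_fls_lower_bound[where N = "-1"]) auto
  have "c m n = hecke_coeff F (int m) n" if "m > 0" "n > 0" for m n
  proof -
    define g where "g = gcd m n"
    define k where "k = m * n"
    have g: "g > 0" "g dvd m" "g dvd n" using that by (auto simp: g_def)
    then have gk: "g * g dvd k" by (simp add: k_def mult_dvd_mono)
    then obtain x where x: "k = g * (g * x)" by (metis dvdE mult.assoc)
    have "k > 0" using that by (simp add: k_def)
    then have "x > 0" by (auto simp: x intro: Nat.gr0I)
    have kg: "k div g = g * x" using g(1) by (simp add: x)
    \<comment> \<open>As g^2 divides k, the pair (g, k/g) has product k and gcd g.\<close>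
    have "c m n = c g (g * x)"
      using that g(1) \<open>x > 0\<close> x by (intro c) (simp_all add: k_def g_def[symmetric] gcd_nat.absorb1)
    then have "c m n = c g (k div g)" by (simp only: kg)
    also have "\<dots> = (\<Sum>s | s dvd g. f k s)" by (rule f[OF g(1)])
    also have "\<dots> = (\<Sum>s | s dvd g. 1 / of_nat s * F s $$ int (m * n div s\<^sup>2))"
    proof (rule sum.cong)
      fix s assume "s \<in> {s. s dvd g}"
      then have s: "s dvd g" by simp
      then have "s > 0" using g(1) by (rule dvd_pos_nat[rotated])
      moreover have "s\<^sup>2 dvd k"
        using s gk by (metis dvd_trans mult_dvd_mono power2_eq_square)
      ultimately show "f k s = 1 / of_nat s * F s $$ int (m * n div s\<^sup>2)"
        using \<open>k > 0\<close> by (auto simp: F_nth k_def[symmetric] div_greater_zero_iff dest: dvd_imp_le)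
    qed simp
    also have "\<dots> = hecke_coeff F (int m) n" by (simp add: hecke_coeff_nat g_def)
    finally show ?thesis .
  qed
  moreover have "normalized_qseries (F s)" for s
    by (simp add: normalized_qseries_def F_nth)
  ultimately show ?thesis by blast
qed

section \<open>Hecke sums as averages over roots of unity\<close>

lemma sum_exp_roots_of_unity:
  assumes "d > 0"
  shows "(\<Sum>b<d. exp (2 * of_real pi * \<i> * of_nat b / of_nat d) powi k) =
      (if int d dvd k then of_nat d else (0 :: complex))"
proof -
  define w :: complex where "w = exp (2 * of_real pi * \<i> * of_int k / of_nat d)"
  have pow: "exp (2 * of_real pi * \<i> * of_nat b / of_nat d) powi k = w ^ b" for b
    by (simp add: w_def exp_of_nat_mult[symmetric] exp_power_int algebra_simps)
  have w_cis: "w = cis (2 * pi * of_int k / of_nat d)"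
    by (simp add: w_def cis_conv_exp mult_ac)
  have "w ^ d = cis (2 * pi * of_int k)"
    using assms by (simp add: w_cis DeMoivre)
  then have wd: "w ^ d = 1" by simp
  have w1: "w = 1 \<longleftrightarrow> int d dvd k"
  proof
    assume "w = 1"
    then have "cos (2 * pi * of_int k / of_nat d) = 1" by (simp add: w_cis complex_eq_iff)
    then obtain j :: int where "2 * pi * of_int k / of_nat d = of_int j * 2 * pi"
      by (auto simp: cos_one_2pi_int)
    then have "real_of_int k = real_of_int (j * int d)"
      using assms by (simp add: field_simps)
    then have "k = j * int d" by (simp only: of_int_eq_iff)
    then show "int d dvd k" by simp
  next
    assume "int d dvd k"
    then obtain j where "k = int d * j" by (rule dvdE)
    then show "w = 1" using assms cis_multiple_2pi[of "of_int j"] by (simp add: w_cis mult.assoc)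
  qed
  show ?thesis
  proof (cases "w = 1")
    case True
    then show ?thesis using w1 by (simp add: pow)
  next
    case False
    then show ?thesis using w1 wd by (simp add: pow sum_gp_strict)
  qed
qed

lemma fls_compose_fps_X_power:
  fixes F :: "'a :: field fls"
  assumes "k > 0"
  shows "fls_compose_fps F (fps_X ^ k) = fls_compose_power F k"
proof -
  define N where "N = fls_subdegree F"
  obtain f where F: "F = fls_shift (- N) (fps_to_fls f)"
    by (metis N_def fls_base_factor_to_fps_to_fls fls_conv_base_factor_to_fps_shift_subdegree)
  have "fls_compose_fps F (fps_X ^ k) = fls_compose_power (fps_to_fls f) k * fls_X_intpow (int k * N)"
    using assms by (simp add: F fls_compose_fps_shift fls_compose_power_fps_to_fls fps_to_fls_power
      power_int_mult flip: fls_X_power_int)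
  then show ?thesis
    using assms by (simp add: F fls_X_intpow_times_conv_shift)
qed

lemma hecke_subst_nth:
  assumes "a > 0"
  shows "hecke_subst F a b d $$ j =
      (if int (a\<^sup>2) dvd j
       then F $$ (j div int (a\<^sup>2)) * exp (2 * of_real pi * \<i> * of_nat b / of_nat d) powi (j div int (a\<^sup>2))
       else 0)"
proof -
  define c :: complex where "c = exp (2 * of_real pi * \<i> * of_nat b / of_nat d)"
  have c: "c \<noteq> 0" by (simp add: c_def)
  \<comment> \<open>Scaling by \<open>c\<close>, which multiplies the k-th coefficient by c^k, is
    separated from the power substitution, which only spreads the exponents.\<close>
  have "hecke_subst F a b d = fls_compose_fps F ((fps_const c * fps_X) oo (fps_X ^ a\<^sup>2))"
    using assms by (simp add: hecke_subst_def c_def fps_compose_mult_distrib)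
  also have "\<dots> = fls_compose_fps (fls_compose_fps F (fps_const c * fps_X)) (fps_X ^ a\<^sup>2)"
    using assms c by (intro fls_compose_fps_assoc[symmetric]) auto
  also have "\<dots> = fls_compose_power (fls_compose_fps F (fps_const c * fps_X)) (a\<^sup>2)"
    using assms by (intro fls_compose_fps_X_power) simp
  finally show ?thesis
    using assms c by (simp add: fls_nth_compose_power fls_nth_fls_compose_fps_linear c_def del: of_nat_power)
qed

text \<open>In w = q^(1/n), summing over b keeps the exponents j = a^2 d x = n a x, that is, q^m
  with a dividing m. The index j/a^2 is mn/a^2, and the d equal terms turn 1/n into 1/a.\<close>

lemma hecke_sum_nth:
  assumes "n > 0"
  shows "(fls_const (1 / of_nat n) *
      (\<Sum>(a, d) | a * d = n. \<Sum>b<d. hecke_subst (F a) a b d)) $$ j =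
      (if int n dvd j then hecke_coeff F (j div int n) n else 0)"
proof -
  have inner: "(\<Sum>b<d. hecke_subst (F a) a b d $$ j) =
      (if int n dvd j \<and> int a dvd j div int n then of_nat d * F a $$ (j div int n * int n div (int a)\<^sup>2) else 0)"
    if "a * d = n" for a d
  proof -
    have pos: "a > 0" "d > 0" using that assms by auto
    define c where "c b = exp (2 * of_real pi * \<i> * of_nat b / of_nat d :: complex)" for b :: nat
    have "(\<Sum>b<d. hecke_subst (F a) a b d $$ j) =
        (if int (a\<^sup>2) dvd j then F a $$ (j div int (a\<^sup>2)) * (\<Sum>b<d. c b powi (j div int (a\<^sup>2))) else 0)"
      using pos by (simp add: hecke_subst_nth c_def sum_distrib_left del: of_nat_power)
    also have "\<dots> = (if int (a\<^sup>2) dvd j \<and> int d dvd j div int (a\<^sup>2) then of_nat d * F a $$ (j div int (a\<^sup>2)) else 0)"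
      using pos by (simp add: c_def sum_exp_roots_of_unity del: of_nat_power)
    also have "int (a\<^sup>2) dvd j \<and> int d dvd j div int (a\<^sup>2) \<longleftrightarrow> int n dvd j \<and> int a dvd j div int n"
    proof
      assume "int (a\<^sup>2) dvd j \<and> int d dvd j div int (a\<^sup>2)"
      then obtain x where "j = int (a\<^sup>2) * (int d * x)" by (metis dvdE dvd_mult_div_cancel)
      then have "j = int n * (int a * x)" by (simp add: that[symmetric] power2_eq_square)
      then show "int n dvd j \<and> int a dvd j div int n" using assms by simp
    next
      assume "int n dvd j \<and> int a dvd j div int n"
      then obtain x where "j = int n * (int a * x)" by (metis dvdE dvd_mult_div_cancel)
      then have "j = int (a\<^sup>2) * (int d * x)" by (simp add: that[symmetric] power2_eq_square)
      then show "int (a\<^sup>2) dvd j \<and> int d dvd j div int (a\<^sup>2)" using pos by simp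
    qed
    finally have "(\<Sum>b<d. hecke_subst (F a) a b d $$ j) = (if int n dvd j \<and> int a dvd j div int n
        then of_nat d * F a $$ (j div int (a\<^sup>2)) else 0)" .
    then show ?thesis
      by (cases "int n dvd j") simp_all
  qed
  have "(\<Sum>(a, d) | a * d = n. \<Sum>b<d. hecke_subst (F a) a b d) $$ j =
      (\<Sum>(a, d) | a * d = n. \<Sum>b<d. hecke_subst (F a) a b d $$ j)"
    by (simp add: fls_nth_sum case_prod_unfold)
  also have "\<dots> = (\<Sum>(a, d) | a * d = n. if int n dvd j \<and> int a dvd j div int n
      then of_nat d * F a $$ (j div int n * int n div (int a)\<^sup>2) else 0)"
    by (intro sum.cong) (auto simp: inner)
  also have "\<dots> = (\<Sum>a | a dvd n. if int n dvd j \<and> int a dvd j div int n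
      then of_nat (n div a) * F a $$ (j div int n * int n div (int a)\<^sup>2) else 0)"
    by (rule sum.reindex_bij_witness[of _ "\<lambda>a. (a, n div a)" fst])
       (use assms in \<open>auto simp: dvd_mult_div_cancel intro: dvdI\<close>)
  finally have sum_eq: "(\<Sum>(a, d) | a * d = n. \<Sum>b<d. hecke_subst (F a) a b d) $$ j =
      (\<Sum>a | a dvd n. if int n dvd j \<and> int a dvd j div int n
      then of_nat (n div a) * F a $$ (j div int n * int n div (int a)\<^sup>2) else 0)" .
  have const_nth: "(fls_const c * f) $$ j = c * f $$ j" for c and f :: "complex fls"
    by simp
  have "(fls_const (1 / of_nat n) *
      (\<Sum>(a, d) | a * d = n. \<Sum>b<d. hecke_subst (F a) a b d)) $$ j =
      (\<Sum>a | a dvd n. if int n dvd j \<and> int a dvd j div int n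
      then 1 / of_nat n * of_nat (n div a) * F a $$ (j div int n * int n div (int a)\<^sup>2) else 0)"
    unfolding const_nth sum_eq by (subst sum_distrib_left, intro sum.cong) auto
  also have "\<dots> = (\<Sum>a | a dvd n. if int n dvd j \<and> int a dvd j div int n
      then 1 / of_nat a * F a $$ (j div int n * int n div (int a)\<^sup>2) else 0)"
    using assms by (intro sum.cong if_cong refl) (auto simp: field_simps elim!: dvdE)
  also have "\<dots> = (if int n dvd j then hecke_coeff F (j div int n) n else 0)"
    using assms by (simp add: hecke_coeff_def flip: sum.inter_filter)
  finally show ?thesis .
qed

subsection \<open>The generating function of the Faber polynomials\<close>

lemma formal_exp_nth_0 [simp]: "formal_exp g $ 0 = 1"
  by (simp add: formal_exp_def)

lemma fps_deriv_formal_exp: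
  assumes "g $ 0 = 0"
  shows "fps_deriv (formal_exp g) = formal_exp g * fps_deriv g"
  using assms by (simp add: formal_exp_def fps_compose_deriv)

text \<open>The integrating factor exp(-g) makes its product with any solution constant, and the
  constant terms fix the constant to 1.\<close>

lemma formal_exp_unique:
  assumes "g $ 0 = 0" "y $ 0 = 1" "fps_deriv y = y * fps_deriv g"
  shows "y = formal_exp g"
proof -
  define z where "z = formal_exp (- g)"
  have z: "fps_deriv z = - (z * fps_deriv g)" "z $ 0 = 1"
    using assms(1) by (simp_all add: z_def fps_deriv_formal_exp)
  have inv: "x * z = 1" if "fps_deriv x = x * fps_deriv g" "x $ 0 = 1" for x
  proof -
    have "fps_deriv (x * z) = 0"
      by (simp add: that z algebra_simps)
    then have "x * z = fps_const ((x * z) $ 0)"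
      by (simp only: fps_deriv_eq_0_iff)
    then show ?thesis by (simp add: that z)
  qed
  have "y * z = formal_exp g * z"
    using inv[of y] inv[of "formal_exp g"] assms by (simp add: fps_deriv_formal_exp)
  moreover have "z \<noteq> 0" using z(2) by auto
  ultimately show ?thesis by simp
qed

lemma formal_exp_add:
  assumes "f $ 0 = 0" "g $ 0 = 0"
  shows "formal_exp (f + g) = formal_exp f * formal_exp g"
  using assms
  by (intro formal_exp_unique[symmetric]) (simp_all add: fps_deriv_formal_exp algebra_simps)

lemma formal_exp_0 [simp]: "formal_exp 0 = 1"
  by (simp add: formal_exp_def)

lemma formal_exp_sum:
  assumes "finite A" "\<And>x. x \<in> A \<Longrightarrow> f x $ 0 = 0"
  shows "formal_exp (\<Sum>x\<in>A. f x) = (\<Prod>x\<in>A. formal_exp (f x))"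
  using assms by (induction A) (simp_all add: formal_exp_add fps_sum_nth)

text \<open>Comparing derivatives and cancelling the exponential takes the place of a logarithm:
  product identities become identities of exponents.\<close>

lemma formal_exp_eq_iff:
  assumes "f $ 0 = 0" "g $ 0 = 0"
  shows "formal_exp f = formal_exp g \<longleftrightarrow> f = g"
proof
  assume eq: "formal_exp f = formal_exp g"
  have "formal_exp g \<noteq> 0" by (metis formal_exp_nth_0 fps_zero_nth zero_neq_one)
  moreover have "formal_exp g * fps_deriv f = formal_exp g * fps_deriv g"
    using fps_deriv_formal_exp[OF assms(1)] fps_deriv_formal_exp[OF assms(2)] unfolding eq
    by (rule trans[OF sym])
  ultimately have "fps_deriv f = fps_deriv g" by simp
  then show "f = g" using assms by (simp add: fps_deriv_eq_iff)
qed simp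

section \<open>Faber polynomials from the logarithm of p (u(p) - u(q))\<close>

lemma fls_mult_nth_below:
  fixes f g :: "'a :: semiring_0 fls"
  assumes "\<And>k. k < a \<Longrightarrow> f $$ k = 0" "\<And>k. k < b \<Longrightarrow> g $$ k = 0" "k < a + b"
  shows "(f * g) $$ k = 0"
proof (cases "f = 0 \<or> g = 0")
  case False
  then have "a \<le> fls_subdegree f" "b \<le> fls_subdegree g"
    using assms(1,2) by (auto intro: fls_subdegree_geI)
  then show ?thesis using assms(3) by (intro fls_times_nth_eq0) simp
qed auto

text \<open>Solving for the coefficients of A recursively takes only subtractions and products,
  because B starts with 1. That 1 is exempt from S, so S may be a non-unital ring such as q
  C[[q]].\<close>

lemma fps_quotient_nth_closed:
  fixes A B C :: "'a :: comm_ring_1 fps"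
  assumes "A * B = C" "B $ 0 = 1"
    and C: "\<And>n. C $ n \<in> S" and B: "\<And>n. n > 0 \<Longrightarrow> B $ n \<in> S"
    and "0 \<in> S" "\<And>x y. x \<in> S \<Longrightarrow> y \<in> S \<Longrightarrow> x - y \<in> S" "\<And>x y. x \<in> S \<Longrightarrow> y \<in> S \<Longrightarrow> x * y \<in> S"
  shows "A $ n \<in> S"
proof (induction n rule: less_induct)
  case (less n)
  have add: "x + y \<in> S" if "x \<in> S" "y \<in> S" for x y
    using assms(6)[OF that(1) assms(6)[OF assms(5) that(2)]] by simp
  have "C $ n = (\<Sum>k<Suc n. A $ k * B $ (n - k))"
    by (simp add: assms(1)[symmetric] fps_mult_nth atLeast0AtMost lessThan_Suc_atMost)
  then have "A $ n = C $ n - (\<Sum>k<n. A $ k * B $ (n - k))"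
    by (simp add: assms(2))
  moreover have "(\<Sum>k\<in>K. A $ k * B $ (n - k)) \<in> S" if "finite K" "K \<subseteq> {..<n}" for K
    using that
  proof (induction K)
    case (insert k K)
    then show ?case by (simp add: add assms(7) less B)
  qed (simp add: assms(5))
  ultimately show ?case by (simp add: assms(6) C)
qed

lemma eval_at_series_pCons: "eval_at_series (pCons a P) u = fls_const a + u * eval_at_series P u"
  by (simp add: eval_at_series_def map_poly_pCons)

lemma eval_at_series_smult: "eval_at_series (smult a P) u = fls_const a * eval_at_series P u"
  by (induction P) (simp_all add: eval_at_series_pCons eval_at_series_simps(1) algebra_simps
      flip: fls_const_mult_const)

lemma eval_at_series_mult:
  "eval_at_series (P * Q) u = eval_at_series P u * eval_at_series Q u"
  by (induction P)
     (simp_all add: eval_at_series_pCons eval_at_series_simps(1,2) eval_at_series_smult algebra_simps)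

definition faber_gen :: "complex fls \<Rightarrow> complex fls fps" where
  "faber_gen u = Abs_fps (\<lambda>n. if n = 0 then 0 else eval_at_series (faber_poly u n) u)"

lemma inverse_of_nat_fls: "inverse (of_nat n :: complex fls) = fls_const (1 / of_nat n)"
  by (simp add: fls_of_nat fls_inverse_const flip: inverse_eq_divide)

text \<open>For W = p (u(p) - u(q)), the coefficients of -ln W are polynomials in u, as those of W
  are, and the n-th one differs from q^(-n)/n by an element of q C[[q]]. Uniqueness of Faber
  polynomials identifies them.\<close>

lemma faber_generating_function:
  assumes "normalized_qseries u"
  shows "fls_X_inv * fps_to_fls (formal_exp (- faber_gen u)) = series_in_p u - series_in_q u"
proof -
  define W where "W = Abs_fps (\<lambda>k. if k = 0 then 1 else if k = 1 then - u
      else fls_const (u $$ (int k - 1)))"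
  \<comment> \<open>The logarithm is formal: \<open>Z\<close> = -W'/W is integrated to
    \<open>Y\<close> = -ln W.\<close>
  define Z where "Z = - fps_deriv W * inverse W"
  define Y where "Y = fps_integral0 Z"
  define c where "c = 1 - fps_const fls_X_inv * (fps_X :: complex fls fps)"
  define U where "U = Abs_fps (\<lambda>n. fls_X_intpow (- int n) :: complex fls)"
  \<comment> \<open>\<open>U\<close> is the inverse of \<open>1 - p/q\<close>. Splitting \<open>W = (1 - p/q) V\<close> isolates the polar part of the
    logarithm, since \<open>- ln (1 - p/q) = \<Sum>\<^sub>n q\<^sup>-\<^sup>n p\<^sup>n / n\<close> and \<open>V\<close> is \<open>1\<close> modulo \<open>q\<close>.\<close>
  define V where "V = W * U"
  \<comment> \<open>The derivative of -ln(1 - p/q), with coefficients q^(-n-1).\<close>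
  define Q where "Q = fps_const fls_X_inv * U"

  have u: "u $$ (-1) = 1" "u $$ 0 = 0" "\<And>k. k < -1 \<Longrightarrow> u $$ k = 0"
    using assms by (auto simp: normalized_qseries_def)
  have W0: "W $ 0 = 1" and W_inv: "inverse W * W = 1"
    by (simp_all add: W_def inverse_mult_eq_1)

  have W_eq: "fls_X_inv * fps_to_fls W = series_in_p u - series_in_q u"
  proof (rule fls_eqI)
    fix k :: int
    consider "k < -1" | "k = -1" | "k = 0" | "k > 0" by linarith
    then show "(fls_X_inv * fps_to_fls W) $$ k = (series_in_p u - series_in_q u) $$ k"
      by cases (simp_all add: fls_X_inv_times_conv_shift series_in_p_nth series_in_q_def u W_def nat_eq_iff)
  qed

  have ZW: "Z * W = - fps_deriv W"
    using W_inv by (simp add: Z_def mult.assoc)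
  have Y: "Y $ 0 = 0" "fps_deriv Y = Z" "\<And>n. Y $ Suc n = inverse (of_nat (Suc n)) * Z $ n"
    by (simp_all only: Y_def fps_deriv_fps_integral fps_integral_nth_0_Suc)
  have W_exp: "W = formal_exp (- Y)"
    using ZW by (intro formal_exp_unique) (simp_all add: Y W0 mult.commute)

  have "U * c = 1"
  proof (rule fps_ext)
    fix n
    show "(U * c) $ n = 1 $ n"
      by (cases n) (simp_all add: c_def U_def right_diff_distrib fls_X_inv_times_conv_shift mult.assoc[symmetric] add.commute)
  qed
  then have W_cV: "W = c * V" and Qc: "Q * c = fps_const fls_X_inv"
    by (simp_all add: V_def Q_def mult_ac)
  have c': "fps_deriv c = - fps_const fls_X_inv" and "c \<noteq> 0"
    using \<open>U * c = 1\<close> by (auto simp: c_def)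
  \<comment> \<open>The logarithmic derivative of W = c V is Z = Q - V'/V, here multiplied by c V so
    that \<open>c\<close> can be cancelled.\<close>
  have "c * ((Z - Q) * V) = Z * W - Q * c * V"
    by (simp add: W_cV algebra_simps)
  also have "\<dots> = c * (- fps_deriv V)"
    unfolding ZW Qc by (simp add: W_cV c' algebra_simps del: fps_const_neg)
  finally have ZQV: "(Z - Q) * V = - fps_deriv V"
    using \<open>c \<noteq> 0\<close> by (simp only: mult_cancel_left) simp

  have V0: "V $ 0 = 1"
    by (simp add: V_def U_def W0)
  \<comment> \<open>With K = k + n, the contributions are 1 if K = 0, -u_(K-1), and u_(K-1) from i =
    K if K >= 2; they cancel by normalization. The bound k <= 0 keeps i = K in range.\<close>
  have V_pos: "V $ n $$ k = 0" if "n > 0" "k \<le> 0" for n k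
  proof -
    define K where "K = k + int n"
    have K: "K \<le> int n" using that(2) by (simp add: K_def)
    have shift_nth: "(f * fls_X_intpow (- int l)) $$ k = f $$ (k + int l)" for f :: "complex fls" and l
      unfolding fls_X_intpow_times_conv_shift(2) by simp
    have "V $ n $$ k = (\<Sum>i\<le>n. (W $ i) $$ (k + int (n - i)))"
      unfolding V_def U_def fps_mult_nth fps_nth_Abs_fps fls_nth_sum shift_nth atLeast0AtMost ..
    also have "\<dots> = (\<Sum>i\<le>n. (W $ i) $$ (K - int i))"
      by (intro sum.cong) (simp_all add: K_def of_nat_diff algebra_simps)
    also have "{..n} = insert 0 (insert 1 {2..n})"
      using that(1) by auto
    also have "(\<Sum>i\<in>\<dots>. (W $ i) $$ (K - int i)) =
        (if K = 0 then 1 else 0) - u $$ (K - 1) + (\<Sum>i=2..n. (W $ i) $$ (K - int i))"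
      by (simp add: W_def)
    also have "(\<Sum>i=2..n. (W $ i) $$ (K - int i)) =
        (\<Sum>i=2..n. if i = nat K then (if K \<ge> 2 then u $$ (K - 1) else 0) else 0)"
      by (intro sum.cong) (auto simp: W_def)
    also have "\<dots> = (if K \<ge> 2 then u $$ (K - 1) else 0)"
      using K by (simp add: nat_le_iff le_nat_iff)
    also have "(if K = 0 then 1 else 0) - u $$ (K - 1) + \<dots> = 0"
    proof -
      consider "K < 0" | "K = 0" | "K = 1" | "K \<ge> 2" by linarith
      then show ?thesis by cases (simp_all add: u)
    qed
    finally show ?thesis .
  qed

  \<comment> \<open>Here the closed set is the ring of polynomials in u; for \<open>Z_nth\<close>
    below it is q C[[q]].\<close>
  have Z_poly: "Z $ n \<in> range (\<lambda>P. eval_at_series P u)" for n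
  proof (rule fps_quotient_nth_closed[OF ZW W0])
    have const: "fls_const a = eval_at_series [:a:] u" for a
      by (simp add: eval_at_series_pCons eval_at_series_simps(1))
    have "u = eval_at_series [:0, 1:] u"
      by (simp add: eval_at_series_pCons eval_at_series_simps(1))
    then have "- u = eval_at_series (- [:0, 1:]) u"
      by (metis add.inverse_neutral diff_0 eval_at_series_simps(1,3))
    then have W_poly: "\<exists>P. W $ n = eval_at_series P u" if "n > 0" for n
      using that const by (cases "n = 1") (auto simp: W_def simp del: One_nat_def)
    have "\<exists>P. (- fps_deriv W) $ n = eval_at_series P u" for n
    proof -
      obtain P where "W $ Suc n = eval_at_series P u" using W_poly by blast
      then have "(- fps_deriv W) $ n = eval_at_series (smult (- of_nat (Suc n)) P) u"
        by (simp add: eval_at_series_smult fls_of_nat del: smult_minus_left flip: of_nat_Suc)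
      then show ?thesis by blast
    qed
    then show "(- fps_deriv W) $ n \<in> range (\<lambda>P. eval_at_series P u)" for n
      by auto
    show "W $ n \<in> range (\<lambda>P. eval_at_series P u)" if "n > 0" for n
      using W_poly[OF that] by auto
    show "0 \<in> range (\<lambda>P. eval_at_series P u)"
      using eval_at_series_simps(1)[of u, symmetric] by blast
  qed (auto simp flip: eval_at_series_simps(3) eval_at_series_mult)

  have Z_nth: "(Z - Q) $ n \<in> {f. \<forall>k\<le>0. f $$ k = 0}" for n
  proof (rule fps_quotient_nth_closed[OF ZQV V0])
    show "(- fps_deriv V) $ n \<in> {f. \<forall>k\<le>0. f $$ k = 0}" for n
      by (auto simp: V_pos fls_of_nat simp flip: of_nat_Suc)
    show "V $ n \<in> {f. \<forall>k\<le>0. f $$ k = 0}" if "n > 0" for n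
      using V_pos that by simp
    show "f * g \<in> {f. \<forall>k\<le>0. f $$ k = 0}"
      if "f \<in> {f. \<forall>k\<le>0. f $$ k = 0}" "g \<in> {f. \<forall>k\<le>0. f $$ k = 0}" for f g :: "complex fls"
      using that fls_mult_nth_below[of 1 f 1 g] by auto
  qed auto

  have "Y = faber_gen u"
  proof (rule fps_ext)
    fix n
    show "Y $ n = faber_gen u $ n"
    proof (cases n)
      case (Suc l)
      define C :: complex where "C = 1 / of_nat n"
      obtain P where "Z $ l = eval_at_series P u" using Z_poly by blast
      then have Yn: "Y $ n = eval_at_series (smult C P) u"
        unfolding Suc Y(3) inverse_of_nat_fls eval_at_series_smult by (simp add: C_def Suc)
      \<comment> \<open>Integration sends p^l to p^n/n with n = l + 1, and \<open>Q $ l\<close> =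
        q^(-n) supplies the polar term q^(-n)/n.\<close>
      have "Y $ n - fls_const C * fls_X_intpow (- int n) = fls_const C * (Z - Q) $ l"
        unfolding Suc Y(3) inverse_of_nat_fls
        by (simp add: C_def Suc Q_def U_def right_diff_distrib fls_X_inv_times_conv_shift add.commute)
      then have "is_faber_poly u n (smult C P)"
        unfolding is_faber_poly_def C_def[symmetric] Yn[symmetric] using Z_nth[of l] by simp
      then have "smult C P = faber_poly u n"
        using faber_poly_ex1[OF assms] faber_poly_correct[OF assms] by blast
      then show ?thesis unfolding Yn by (simp add: faber_gen_def Suc)
    qed (simp add: Y faber_gen_def)
  qed
  then show ?thesis using W_exp W_eq by simp
qed

subsection \<open>The infinite product\<close>

lemma has_formal_prod_unique:
  assumes "has_formal_prod f I P" "has_formal_prod f I Q"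
  shows "P = Q"
proof -
  have "(P $ i) $$ j = (Q $ i) $$ j" for i j
  proof -
    have "\<forall>\<^sub>F A in finite_subsets_at_top I. (P $ i) $$ j = (Q $ i) $$ j"
      using assms[unfolded has_formal_prod_def, rule_format, of i j]
      by eventually_elim simp
    then show ?thesis by simp
  qed
  then show ?thesis by (intro fps_ext fls_eqI)
qed

text \<open>
  Infinitely many factors have \<open>n\<close> below any given bound, so the \<open>p\<close>-adic order does not control the
  product. Giving \<open>q\<^sup>m p\<^sup>n\<close> the weight \<open>m + n\<close> does: only the factor at \<open>(-1, 1)\<close> has weight \<open>0\<close>, and
  every other nontrivial one has \<open>m, n > 0\<close>.
\<close>

definition weight_ge :: "int \<Rightarrow> complex fls fps \<Rightarrow> bool" where
  "weight_ge L g \<longleftrightarrow> (\<forall>n k. k + int n < L \<longrightarrow> (g $ n) $$ k = 0)"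

lemma weight_ge_mult:
  assumes "weight_ge a f" "weight_ge b g"
  shows "weight_ge (a + b) (f * g)"
  unfolding weight_ge_def
proof (intro allI impI)
  fix n k
  assume k: "k + int n < a + b"
  have "(f $ i * g $ (n - i)) $$ k = 0" if "i \<le> n" for i
    by (rule fls_mult_nth_below[of "a - int i" _ "b - int (n - i)"])
       (use assms k that in \<open>auto simp: weight_ge_def\<close>)
  then show "((f * g) $ n) $$ k = 0"
    by (simp add: fps_mult_nth fls_nth_sum)
qed

lemma weight_ge_1 [simp]: "weight_ge 0 1"
  by (simp add: weight_ge_def fps_one_nth)

lemma weight_ge_power:
  assumes "weight_ge L g" "L \<ge> 0" "k > 0"
  shows "weight_ge L (g ^ k)"
proof -
  have "weight_ge L (g ^ Suc l)" for l
  proof (induction l)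
    case (Suc l)
    have "weight_ge (L + L) (g * g ^ Suc l)"
      by (rule weight_ge_mult[OF assms(1) Suc.IH])
    then show ?case using assms(2) by (auto simp: weight_ge_def)
  qed (use assms in simp)
  then show ?thesis using assms(3) gr0_implies_Suc by blast
qed

text \<open>As L >= 0, all positive powers of g keep the bound. Applied to a difference of
  exponents, this lets exponents be truncated at weight L.\<close>

lemma weight_ge_formal_exp:
  assumes "weight_ge L g" "L \<ge> 0"
  shows "weight_ge L (formal_exp g - 1)"
  unfolding weight_ge_def
proof (intro allI impI)
  fix n k
  assume k: "k + int n < L"
  have "fps_exp 1 $ i = fls_const (1 / of_nat (fact i) :: complex)" for i
    using inverse_of_nat_fls[of "fact i"] by (simp add: inverse_eq_divide)
  then have "formal_exp g $ n = (\<Sum>i=0..n. fls_const (1 / of_nat (fact i)) * (g ^ i $ n))"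
    by (simp only: formal_exp_def fps_compose_nth)
  also have "\<dots> = 1 $ n + (\<Sum>i=Suc 0..n. fls_const (1 / of_nat (fact i)) * (g ^ i $ n))"
    by (subst sum.atLeast_Suc_atMost) auto
  finally have "(formal_exp g - 1) $ n = (\<Sum>i=Suc 0..n. fls_const (1 / of_nat (fact i)) * (g ^ i $ n))"
    by simp
  moreover have "(g ^ i $ n) $$ k = 0" if "i \<ge> Suc 0" for i
    using weight_ge_power[OF assms, of i] k that by (simp add: weight_ge_def)
  ultimately show "((formal_exp g - 1) $ n) $$ k = 0"
    by (simp add: fls_nth_sum)
qed

section \<open>Collecting the exponents of all factors\<close>

lemma factor_exponent_nth:
  assumes "n > 0"
  shows "(factor_exponent \<psi> F r m n $ N) $$ M =
    (if N > 0 \<and> n dvd N \<and> M = int (N div n) * m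
     then (of_int (\<psi> M N) * F (N div n) $$ (m * int n) + r (N div n) $$ (m * int n)) / (2 * of_nat (N div n))
     else 0)"
proof -
  have "{s. s \<ge> 1 \<and> s * n = N} = (if N > 0 \<and> n dvd N then {N div n} else {})"
    using assms by (auto elim!: dvdE)
  then show ?thesis
    by (auto simp: factor_exponent_def fls_X_intpow_times_conv_shift)
qed

text \<open>Minus the logarithm of the product: q^m p^n receives a term with index mn/s^2 from the
  factor (m/s, n/s) for each common divisor s, and \<psi>(m,n) is common to all of them.\<close>

definition log_exponent ::
    "(int \<Rightarrow> nat \<Rightarrow> int) \<Rightarrow> (nat \<Rightarrow> complex fls) \<Rightarrow> (nat \<Rightarrow> complex fls) \<Rightarrow> complex fls fps" where
  "log_exponent \<psi> F r = Abs_fps (\<lambda>n. Abs_fls (\<lambda>m.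
     if n = 0 then 0 else (of_int (\<psi> m n) * hecke_coeff F m n + hecke_coeff r m n) / 2))"

lemma log_exponent_nth:
  assumes "\<forall>s\<ge>1. normalized_qseries (F s)" "\<forall>s\<ge>1. normalized_qseries (r s)"
  shows "(log_exponent \<psi> F r $ n) $$ m =
    (if n = 0 then 0 else (of_int (\<psi> m n) * hecke_coeff F m n + hecke_coeff r m n) / 2)"
  unfolding log_exponent_def fps_nth_Abs_fps
  by (rule nth_Abs_fls_lower_bound[where N = "- int n"])
     (auto simp: hecke_coeff_nonpos[OF assms(1)] hecke_coeff_nonpos[OF assms(2)])

text \<open>For each monomial, a large enough finite set of factors already has the full exponent up
  to that weight, and exponentiation preserves the agreement.\<close>

lemma has_formal_prod_factor_exponent:
  assumes F: "\<forall>s\<ge>1. normalized_qseries (F s)" and r: "\<forall>s\<ge>1. normalized_qseries (r s)"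
  shows "has_formal_prod (\<lambda>(m, n). formal_exp (- factor_exponent \<psi> F r m n))
    {(m, n). n > 0} (formal_exp (- log_exponent \<psi> F r))"
  unfolding has_formal_prod_def
proof (intro allI)
  fix i :: nat and j :: int
  \<comment> \<open>L exceeds the weight of p^i q^j. \<open>A0\<close> holds the pair of weight 0
    and all positive pairs of weight below L.\<close>
  define L where "L = max 0 (j + int i + 1)"
  define A0 where "A0 = insert (-1, 1) ({1..L} \<times> {1..nat L})"
  define e where "e = (\<lambda>(m, n). factor_exponent \<psi> F r m n)"
  define E where "E = log_exponent \<psi> F r"
  have L: "L \<ge> 0" "j + int i < L" by (auto simp: L_def)
  have E0: "E $ 0 = 0"
    by (rule fls_eqI) (simp add: E_def log_exponent_nth[OF F r])
  have e0: "e x $ 0 = 0" if "snd x > 0" for x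
    by (rule fls_eqI) (use that in \<open>auto simp: e_def factor_exponent_nth split: prod.split\<close>)

  have vanish: "F s $$ (m * int n) = 0 \<and> r s $$ (m * int n) = 0"
    if "s > 0" "n > 0" "m \<le> 0" "(m, n) \<noteq> (-1, 1)" for s m n
  proof -
    have "m * int n \<noteq> -1"
    proof
      assume eq: "m * int n = -1"
      then have "int n dvd 1" by (metis dvd_minus_iff dvd_triv_right)
      then have "n = 1" by simp
      with eq that(4) show False by simp
    qed
    moreover have "m * int n \<le> 0" using that by (simp add: mult_nonpos_nonneg)
    ultimately show ?thesis
      using F r that(1) normalized_nth_nonpos[of _ "m * int n"] by simp
  qed

  have weight_e: "weight_ge 0 (e x)" if "snd x > 0" for x
  proof -
    obtain m n where x: "x = (m, n)" by (cases x)
    have "(factor_exponent \<psi> F r m n $ N) $$ M = 0" if "M + int N < 0" for M N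
    proof (rule ccontr)
      assume nz: "(factor_exponent \<psi> F r m n $ N) $$ M \<noteq> 0"
      have n: "n > 0" using \<open>snd x > 0\<close> x by simp
      define s where "s = N div n"
      have s: "N > 0" "N = s * n" "M = int s * m"
        using nz n by (auto simp: factor_exponent_nth s_def split: if_splits)
      then have "s > 0" by (auto intro: Nat.gr0I)
      have "M + int N = int s * (m + int n)" by (simp add: s algebra_simps)
      with that \<open>s > 0\<close> have "m + int n < 0" by (simp add: mult_less_0_iff)
      then have "F s $$ (m * int n) = 0 \<and> r s $$ (m * int n) = 0"
        using \<open>s > 0\<close> n by (intro vanish) auto
      then show False using nz n by (auto simp: factor_exponent_nth s_def split: if_splits)
    qed
    then show ?thesis by (simp add: weight_ge_def e_def x)
  qed

  have coeff_eq: "(E $ N) $$ M = (\<Sum>x\<in>A. (e x $ N) $$ M)"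
    if A: "finite A" "A0 \<subseteq> A" "A \<subseteq> {(m, n). n > 0}" and MN: "M + int N < L" for A M N
  proof (cases "N = 0")
    case True
    then show ?thesis using A E0 e0 by (subst sum.neutral) auto
  next
    case False
    define c where "c s k = (of_int (\<psi> M N) * F s $$ k + r s $$ k) / (2 * of_nat s)" for s k
    have "(E $ N) $$ M = (\<Sum>s | s dvd N \<and> int s dvd M. c s (M * int N div (int s)\<^sup>2))"
      using False unfolding E_def log_exponent_nth[OF F r] hecke_coeff_def
      by (simp add: c_def sum_distrib_left sum.distrib[symmetric] sum_divide_distrib add_divide_distrib mult_ac)
    also have "\<dots> = (\<Sum>x\<in>A. (e x $ N) $$ M)"
    \<comment> \<open>A divisor s corresponds to the pair (M/s, N/s). The exceptional sets are
      divisors whose pair is outside \<open>A\<close> and pairs of \<open>A\<close> not of this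
      form; both contribute zero.\<close>
    proof (rule sum.reindex_bij_witness_not_neutral[where
          i = "\<lambda>x. N div snd x" and j = "\<lambda>s. (M div int s, N div s)" and
          S' = "{s. s dvd N \<and> int s dvd M \<and> (M div int s, N div s) \<notin> A}" and
          T' = "{(m, n) \<in> A. \<not> (n dvd N \<and> M = int (N div n) * m)}"])
      show "finite {s. s dvd N \<and> int s dvd M \<and> (M div int s, N div s) \<notin> A}"
        using False by simp
      show "finite {(m, n) \<in> A. \<not> (n dvd N \<and> M = int (N div n) * m)}"
        using A(1) by (rule finite_subset[rotated]) auto
    next
      fix s assume s: "s \<in> {s. s dvd N \<and> int s dvd M} - {s. s dvd N \<and> int s dvd M \<and> (M div int s, N div s) \<notin> A}"
      then show "N div snd (M div int s, N div s) = s"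
        using False by (auto elim!: dvdE)
      show "(M div int s, N div s) \<in> A - {(m, n) \<in> A. \<not> (n dvd N \<and> M = int (N div n) * m)}"
        using s False by (auto elim!: dvdE)
    next
      fix x assume x: "x \<in> A - {(m, n) \<in> A. \<not> (n dvd N \<and> M = int (N div n) * m)}"
      then obtain m n where mn: "x = (m, n)" "n dvd N" "M = int (N div n) * m" "(m, n) \<in> A" by auto
      then have n: "n > 0" using A(3) by auto
      define s where "s = N div n"
      have s: "N = s * n" "M = int s * m" "s > 0" using mn n False by (auto simp: s_def elim!: dvdE)
      show "(M div int (N div snd x), N div (N div snd x)) = x"
        using s n by (simp add: mn)
      show "N div snd x \<in> {s. s dvd N \<and> int s dvd M} - {s. s dvd N \<and> int s dvd M \<and> (M div int s, N div s) \<notin> A}"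
        using s n mn(4) by (simp add: mn)
    next
      fix s assume "s \<in> {s. s dvd N \<and> int s dvd M \<and> (M div int s, N div s) \<notin> A}"
      then have "s dvd N" "int s dvd M" and nA: "(M div int s, N div s) \<notin> A"
        by auto
      then obtain m n where mn: "N = s * n" "M = int s * m"
        by (blast elim: dvdE)
      have pos: "s > 0" "n > 0" using mn False by auto
      have "(m, n) \<notin> A0" using nA A(2) pos by (auto simp: mn)
      \<comment> \<open>Dividing by s >= 1 does not increase a positive weight, so a pair with m > 0
        would lie in \<open>A0\<close>; hence m <= 0 and the coefficients vanish.\<close>
      moreover have "m + int n < L" if "m > 0"
      proof -
        have "1 * (m + int n) \<le> int s * (m + int n)"
          using pos that by (intro mult_right_mono) auto
        then show ?thesis using MN by (simp add: mn algebra_simps)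
      qed
      ultimately have "m \<le> 0" "(m, n) \<noteq> (-1, 1)"
        using pos by (force simp: A0_def)+
      then show "c s (M * int N div (int s)\<^sup>2) = 0"
        using vanish[OF pos] pos by (simp add: mn c_def power2_eq_square)
    next
      fix x assume "x \<in> {(m, n) \<in> A. \<not> (n dvd N \<and> M = int (N div n) * m)}"
      then show "(e x $ N) $$ M = 0"
        using A(3) by (auto simp: e_def factor_exponent_nth)
    next
      fix s assume "s \<in> {s. s dvd N \<and> int s dvd M}"
      then have "s dvd N" "int s dvd M" by auto
      then obtain m n where mn: "N = s * n" "M = int s * m" by (blast elim: dvdE)
      have pos: "s > 0" "n > 0" using mn False by auto
      then show "(e (M div int s, N div s) $ N) $$ M = c s (M * int N div (int s)\<^sup>2)"
        using False by (simp add: mn e_def factor_exponent_nth c_def power2_eq_square)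
    qed
    finally show ?thesis .
  qed

  have prod_eq: "((\<Prod>(m, n)\<in>A. formal_exp (- factor_exponent \<psi> F r m n)) $ i) $$ j = (formal_exp (- E) $ i) $$ j"
    if A: "finite A" "A0 \<subseteq> A" "A \<subseteq> {(m, n). n > 0}" for A
  proof -
    define S where "S = (\<Sum>x\<in>A. - e x)"
    have snd_pos: "snd x > 0" if "x \<in> A" for x using A(3) that by auto
    have S0: "S $ 0 = 0" using e0 snd_pos by (simp add: S_def fps_sum_nth)
    have prod_S: "(\<Prod>(m, n)\<in>A. formal_exp (- factor_exponent \<psi> F r m n)) = formal_exp S"
      using A(1) e0 snd_pos by (simp add: S_def formal_exp_sum e_def case_prod_unfold)
    have "weight_ge 0 S"
      using weight_e snd_pos by (simp add: S_def weight_ge_def fps_sum_nth fls_nth_sum sum_negf)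
    then have "weight_ge 0 (formal_exp S - 1)"
      by (rule weight_ge_formal_exp) simp
    then have "weight_ge 0 (formal_exp S)"
      using weight_ge_1 by (simp add: weight_ge_def)
    moreover have "weight_ge L (- E - S)"
      using coeff_eq[OF A] by (simp add: weight_ge_def S_def fps_sum_nth fls_nth_sum sum_negf)
    then have "weight_ge L (formal_exp (- E - S) - 1)"
      using L(1) by (rule weight_ge_formal_exp)
    ultimately have "weight_ge (0 + L) (formal_exp S * (formal_exp (- E - S) - 1))"
      by (rule weight_ge_mult)
    \<comment> \<open>The error factors into exp(S), of weight at least 0, and a term of weight at
      least L.\<close>
    moreover have "formal_exp S * (formal_exp (- E - S) - 1) = formal_exp (- E) - formal_exp S"
      using formal_exp_add[of S "- E - S"] S0 E0 by (simp add: right_diff_distrib)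
    ultimately have "((formal_exp (- E) - formal_exp S) $ i) $$ j = 0"
      using L(2) by (simp add: weight_ge_def)
    then show ?thesis by (simp add: prod_S)
  qed
  show "\<forall>\<^sub>F A in finite_subsets_at_top {(m, n). n > 0}.
      ((\<Prod>(m, n)\<in>A. formal_exp (- factor_exponent \<psi> F r m n)) $ i) $$ j =
      (formal_exp (- log_exponent \<psi> F r) $ i) $$ j"
    unfolding eventually_finite_subsets_at_top E_def[symmetric]
  proof (intro exI[of _ A0] conjI allI impI)
    show "finite A0" "A0 \<subseteq> {(m, n). n > 0}" by (auto simp: A0_def)
    fix A
    assume "finite A \<and> A0 \<subseteq> A \<and> A \<subseteq> {(m, n). n > 0}"
    then show "((\<Prod>(m, n)\<in>A. formal_exp (- factor_exponent \<psi> F r m n)) $ i) $$ j =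
        (formal_exp (- E) $ i) $$ j"
      by (intro prod_eq) simp_all
  qed
qed

subsection \<open>The equivalences\<close>

lemma faber_coeff_1:
  assumes "normalized_qseries u"
  shows "faber_coeff u m 1 = u $$ m"
proof -
  have "is_faber_poly u 1 [:0, 1:]"
    using assms by (auto simp: is_faber_poly_def eval_at_series_pCons eval_at_series_simps(1)
        normalized_nth_nonpos)
  then have "faber_poly u 1 = [:0, 1:]"
    using faber_poly_ex1[OF assms] faber_poly_correct[OF assms] by blast
  then show ?thesis
    by (simp add: faber_coeff_def eval_at_series_pCons eval_at_series_simps(1))
qed

lemma super_replicable_iff:
  "super_replicable t t\<^sub>0 \<psi> \<longleftrightarrow> (\<exists>F. (\<forall>s\<ge>1. normalized_qseries (F s)) \<and>
     (\<forall>m>0. \<forall>n>0. twisted_coeff t t\<^sub>0 \<psi> (int m) n = hecke_coeff F (int m) n))"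
proof
  assume super: "super_replicable t t\<^sub>0 \<psi>"
  show "\<exists>F. (\<forall>s\<ge>1. normalized_qseries (F s)) \<and>
     (\<forall>m>0. \<forall>n>0. twisted_coeff t t\<^sub>0 \<psi> (int m) n = hecke_coeff F (int m) n)"
    by (rule hecke_coeff_exists, rule super[unfolded super_replicable_def, rule_format])
next
  assume "\<exists>F. (\<forall>s\<ge>1. normalized_qseries (F s)) \<and>
     (\<forall>m>0. \<forall>n>0. twisted_coeff t t\<^sub>0 \<psi> (int m) n = hecke_coeff F (int m) n)"
  then obtain F where F: "(\<forall>s\<ge>1. normalized_qseries (F s)) \<and>
     (\<forall>m>0. \<forall>n>0. twisted_coeff t t\<^sub>0 \<psi> (int m) n = hecke_coeff F (int m) n)"
    by (rule exE)
  show "super_replicable t t\<^sub>0 \<psi>"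
    unfolding super_replicable_def
  proof (intro allI impI)
    fix a b c d :: nat
    assume "a > 0" "b > 0" "c > 0" "d > 0" "a * b = c * d" "gcd a b = gcd c d"
    then show "twisted_coeff t t\<^sub>0 \<psi> (int a) b = twisted_coeff t t\<^sub>0 \<psi> (int c) d"
      using hecke_coeff_gcd_mult_cong[of a b c d F] F by presburger
  qed
qed

text \<open>The polar terms combine to 2/n - 1/n = 1/n, matching \<open>hecke_coeff_nonpos\<close>,
  so the comparison with \<open>hecke_coeff\<close> is decided at m > 0.\<close>

lemma twisted_coeff_nonpos:
  assumes "normalized_qseries t" "normalized_qseries t\<^sub>0" "admissible_sign \<psi>" "n > 0" "m \<le> 0"
  shows "twisted_coeff t t\<^sub>0 \<psi> m n = (if m = - int n then 1 / of_nat n else 0)"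
  using assms by (simp add: twisted_coeff_def faber_coeff_nonpos admissible_sign_def)

lemma twisted_coeff_1:
  assumes "normalized_qseries t" "normalized_qseries t\<^sub>0" "admissible_sign \<psi>"
  shows "twisted_coeff t t\<^sub>0 \<psi> m 1 = (2 * t - t\<^sub>0) $$ m"
proof -
  have "of_int (\<psi> m 1) * (2 * t - t\<^sub>0) $$ m = (2 * t - t\<^sub>0) $$ m"
  proof (cases "m > 0")
    case False
    moreover have "\<psi> (-1) 1 = 1"
      using assms(3) unfolding admissible_sign_def by (metis of_nat_1 zero_less_one)
    ultimately show ?thesis
      using assms(1,2) by (simp add: normalized_nth_nonpos)
  qed (use assms in \<open>simp add: admissible_sign_def\<close>)
  then show ?thesis
    using assms by (simp add: twisted_coeff_def faber_coeff_1 del: One_nat_def)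
qed

context
  fixes t t\<^sub>0 :: "complex fls" and r :: "nat \<Rightarrow> complex fls" and \<psi> :: "int \<Rightarrow> nat \<Rightarrow> int"
  assumes t: "normalized_qseries t" and t0: "normalized_qseries t\<^sub>0"
    and repl: "replicable_with t\<^sub>0 r" and sign: "admissible_sign \<psi>"
begin

lemma twisted_coeff_eq_iff:
  assumes F: "\<forall>s\<ge>1. normalized_qseries (F s)"
  shows "(\<forall>m>0. \<forall>n>0. twisted_coeff t t\<^sub>0 \<psi> (int m) n = hecke_coeff F (int m) n) \<longleftrightarrow>
    (\<forall>m. \<forall>n>0. twisted_coeff t t\<^sub>0 \<psi> m n = hecke_coeff F m n)"
proof (intro iffI allI impI)
  fix m :: int and n :: nat
  assume *: "\<forall>m>0. \<forall>n>0. twisted_coeff t t\<^sub>0 \<psi> (int m) n = hecke_coeff F (int m) n" and n: "n > 0"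
  show "twisted_coeff t t\<^sub>0 \<psi> m n = hecke_coeff F m n"
  proof (cases "m > 0")
    case True
    then show ?thesis using *[rule_format, of "nat m" n] n by simp
  next
    case False
    then show ?thesis
      using twisted_coeff_nonpos[OF t t0 sign n] hecke_coeff_nonpos[OF F n] by simp
  qed
qed simp

text \<open>Both sides are series in w = q^(1/n) supported on multiples of n. The equation for
  \<open>F 1\<close> is the case n = 1, whose only divisor is 1.\<close>

lemma hecke_identity_iff:
  assumes F: "\<forall>s\<ge>1. normalized_qseries (F s)"
  shows "F 1 = 2 * t - t\<^sub>0 \<and>
      (\<forall>n\<ge>1. fls_compose_power (twisted_series t t\<^sub>0 \<psi> n) n =
        fls_const (1 / of_nat n) * (\<Sum>(a, d) | a * d = n. \<Sum>b<d. hecke_subst (F a) a b d)) \<longleftrightarrow>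
    (\<forall>m. \<forall>n>0. twisted_coeff t t\<^sub>0 \<psi> m n = hecke_coeff F m n)" (is "?F1 \<and> ?L \<longleftrightarrow> ?R")
proof -
  have "fls_compose_power (twisted_series t t\<^sub>0 \<psi> n) n =
      fls_const (1 / of_nat n) * (\<Sum>(a, d) | a * d = n. \<Sum>b<d. hecke_subst (F a) a b d) \<longleftrightarrow>
      (\<forall>m. twisted_coeff t t\<^sub>0 \<psi> m n = hecke_coeff F m n)" (is "?l = ?r \<longleftrightarrow> ?c") if n: "n > 0" for n
  proof -
    have l: "?l $$ j = (if int n dvd j then twisted_coeff t t\<^sub>0 \<psi> (j div int n) n else 0)" for j
      using n by (simp add: fls_nth_compose_power twisted_series_nth[OF t t0])
    have r: "?r $$ j = (if int n dvd j then hecke_coeff F (j div int n) n else 0)" for j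
      by (rule hecke_sum_nth[OF n])
    show ?thesis
    proof
      assume eq: "?l = ?r"
      show ?c
      proof
        fix m
        show "twisted_coeff t t\<^sub>0 \<psi> m n = hecke_coeff F m n"
          using l[of "int n * m"] r[of "int n * m"] n unfolding eq by simp
      qed
    next
      assume ?c
      then show "?l = ?r" by (intro fls_eqI) (simp only: l r)
    qed
  qed
  then have "?L \<longleftrightarrow> ?R" by (auto simp: Suc_le_eq)
  moreover have ?F1 if ?R
  proof (rule fls_eqI)
    fix m
    have "(2 * t - t\<^sub>0) $$ m = hecke_coeff F m 1"
      using that twisted_coeff_1[OF t t0 sign] by simp
    also have "\<dots> = F 1 $$ m"
      by (simp add: hecke_coeff_def cong: conj_cong)
    finally show "F 1 $$ m = (2 * t - t\<^sub>0) $$ m" by simp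
  qed
  ultimately show ?thesis by blast
qed

text \<open>The value of the product is unique and the exponential injective, so the identity
  equates the total exponent with \<open>faber_gen t\<close>; replicability turns the
  \<open>r\<close> part into h_(m,n).\<close>

lemma product_identity_iff:
  assumes F: "\<forall>s\<ge>1. normalized_qseries (F s)"
  shows "(\<exists>P. has_formal_prod (\<lambda>(m, n). formal_exp (- factor_exponent \<psi> F r m n))
        {(m, n). n > 0} P \<and> fls_X_inv * fps_to_fls P = series_in_p t - series_in_q t) \<longleftrightarrow>
    (\<forall>m. \<forall>n>0. twisted_coeff t t\<^sub>0 \<psi> m n = hecke_coeff F m n)" (is "?L \<longleftrightarrow> ?R")
proof -
  have r: "\<forall>s\<ge>1. normalized_qseries (r s)"
    using repl by (simp add: replicable_with_def)
  have h: "faber_coeff t\<^sub>0 m n = hecke_coeff r m n" if "n > 0" for m n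
  proof (cases "m > 0")
    case True
    then obtain k where k: "m = int k" "k > 0" using zero_less_imp_eq_int by blast
    show ?thesis
      using repl[unfolded replicable_with_def] k(2) that unfolding k(1) hecke_coeff_nat by simp
  next
    case False
    then show ?thesis using that by (simp add: faber_coeff_nonpos[OF t0] hecke_coeff_nonpos[OF r])
  qed
  define E where "E = log_exponent \<psi> F r"
  have E_nth: "(E $ n) $$ m =
      (if n = 0 then 0 else (of_int (\<psi> m n) * hecke_coeff F m n + hecke_coeff r m n) / 2)" for m n
    unfolding E_def by (rule log_exponent_nth[OF F r])
  have E0: "E $ 0 = 0" by (rule fls_eqI) (simp add: E_nth)
  have prod_E: "has_formal_prod (\<lambda>(m, n). formal_exp (- factor_exponent \<psi> F r m n))
      {(m, n). n > 0} (formal_exp (- E))"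
    unfolding E_def by (rule has_formal_prod_factor_exponent[OF F r])
  have "?L \<longleftrightarrow> fls_X_inv * fps_to_fls (formal_exp (- E)) = series_in_p t - series_in_q t"
    using prod_E has_formal_prod_unique[OF prod_E] by (metis (no_types, lifting))
  also have "\<dots> \<longleftrightarrow> formal_exp (- E) = formal_exp (- faber_gen t)"
    by (simp add: faber_generating_function[OF t, symmetric])
  also have "\<dots> \<longleftrightarrow> E = faber_gen t"
    using E0 by (simp add: formal_exp_eq_iff faber_gen_def)
  also have "\<dots> \<longleftrightarrow> (\<forall>n>0. \<forall>m. (E $ n) $$ m = faber_coeff t m n)"
  proof -
    have "(E $ n = faber_gen t $ n) \<longleftrightarrow> (n > 0 \<longrightarrow> (\<forall>m. (E $ n) $$ m = faber_coeff t m n))" for n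
      using E0 by (cases "n = 0") (simp_all add: faber_gen_def faber_coeff_def fls_eq_iff)
    then show ?thesis by (simp add: fps_eq_iff)
  qed
  also have "\<dots> \<longleftrightarrow> ?R"
  proof -
    have "(E $ n) $$ m = faber_coeff t m n \<longleftrightarrow> twisted_coeff t t\<^sub>0 \<psi> m n = hecke_coeff F m n"
      if n: "n > 0" for m n
    proof (cases "m > 0")
      case True
      then have "\<psi> m n = 1 \<or> \<psi> m n = -1"
        using sign n by (simp add: admissible_sign_def)
      \<comment> \<open>For either sign, 2H = \<psi> x + h is solved by x = \<psi> (2H - h).\<close>
      moreover have "(x + y) / 2 = z \<longleftrightarrow> 2 * z - y = x" "(- x + y) / 2 = z \<longleftrightarrow> - (2 * z - y) = x"
        for x y z :: complex
        by (auto simp: field_simps)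
      ultimately show ?thesis
        using n by (elim disjE) (simp_all add: E_nth twisted_coeff_def h[OF n])
    next
      \<comment> \<open>Both sides of the equivalence hold here: all coefficients are 1/n at m = -n
        and 0 at other m <= 0.\<close>
      case False
      then have "m \<le> 0" by simp
      moreover have "\<psi> (- int n) n = 1" using sign n by (simp add: admissible_sign_def)
      ultimately show ?thesis
        using n by (simp add: E_nth twisted_coeff_nonpos[OF t t0 sign n] hecke_coeff_nonpos[OF F]
            hecke_coeff_nonpos[OF r] faber_coeff_nonpos[OF t])
    qed
    then show ?thesis by auto
  qed
  finally show ?thesis .
qed

end

theorem theorem8:
  fixes t t\<^sub>0 :: "complex fls"
    and r :: "nat \<Rightarrow> complex fls"
    and \<psi> :: "int \<Rightarrow> nat \<Rightarrow> int"
  assumes "normalized_qseries t"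
    and "normalized_qseries t\<^sub>0"
    and "replicable_with t\<^sub>0 r"
    and "admissible_sign \<psi>"
  shows
    "(super_replicable t t\<^sub>0 \<psi> \<longleftrightarrow>
       (\<exists>F :: nat \<Rightarrow> complex fls. (\<forall>s \<ge> 1. normalized_qseries (F s)) \<and> F 1 = 2 * t - t\<^sub>0 \<and>
          (\<forall>n \<ge> 1. fls_compose_power (twisted_series t t\<^sub>0 \<psi> n) n =
             fls_const (1 / of_nat n) *
               (\<Sum>(a, d) | a * d = n. \<Sum>b<d. hecke_subst (F a) a b d))))
     \<and>
     (super_replicable t t\<^sub>0 \<psi> \<longleftrightarrow>
       (\<exists>F :: nat \<Rightarrow> complex fls. (\<forall>s \<ge> 1. normalized_qseries (F s)) \<and>
          (\<exists>P. has_formal_prod (\<lambda>(m, n). formal_exp (- factor_exponent \<psi> F r m n))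
                 {(m :: int, n :: nat). n > 0} P \<and>
               fls_X_inv * fps_to_fls P = series_in_p t - series_in_q t)))"
proof -
  \<comment> \<open>Both equivalences pass through this condition, with the same witness
    \<open>F\<close> on each side.\<close>
  have "super_replicable t t\<^sub>0 \<psi> \<longleftrightarrow> (\<exists>F. (\<forall>s\<ge>1. normalized_qseries (F s)) \<and>
      (\<forall>m. \<forall>n>0. twisted_coeff t t\<^sub>0 \<psi> m n = hecke_coeff F m n))"
    unfolding super_replicable_iff by (intro iff_exI conj_cong refl twisted_coeff_eq_iff[OF assms])
  then show ?thesis
    by (simp only:)
      (intro conjI iff_exI conj_cong refl hecke_identity_iff[OF assms, symmetric]
        product_identity_iff[OF assms, symmetric])
qed

end
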